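(* Let $\mathcal{P}_{(2,1)}$ be the set of cylindric partitions with profile $(2,1)$. Then $$\sum_{\Lambda\in\mathcal{P}_{(2,1)}} q^{|\Lambda|}z^{\max(\Lambda)}u^{\mathrm{st}(\Lambda)}=1+\sum_{m\ge1}\ \sum_{0<j_1<j_2<\cdots<j_m} f_{2+r_1}f_{2+r_2}\cdots f_{2+r_s}\prod_{k=1}^m\frac{uzq^{j_k}}{1-zq^{j_k}},$$ where the inner sum is over all strictly increasing sequences of $m$ positive integers, and for each such sequence $r_1$ is the length of the maximal run of consecutive numbers in $j_1<j_2<\cdots<j_m$ starting with $j_1$, $r_2$ is the length of the maximal run of consecutive numbers starting with $j_{r_1+1}$, and so on, so that the sequence consists of exactly $s$ maximal runs of consecutive integers with lengths $r_1,\dots,r_s$ in order; and $f_i$ denotes the $i$-th Fibonacci number.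
   Context: A cylindric partition with profile $(2,1)$ is a pair $\Lambda=(\lambda^{(1)},\lambda^{(2)})$ of integer partitions (weakly decreasing, positive parts, missing entries regarded as $0$) such that $\lambda^{(1)}_j\ge\lambda^{(2)}_{j+1}$ and $\lambda^{(2)}_j\ge\lambda^{(1)}_{j+2}$ for all $j\ge1$. $|\Lambda|$ is the sum of all parts of both partitions; $\max(\Lambda)$ is the largest part appearing ($0$ if $\Lambda$ is empty); $\mathrm{st}(\Lambda)$ is the number of distinct positive integers appearing as parts in $\Lambda$. Fibonacci numbers are normalized by $f_1=f_2=1$, $f_{i}=f_{i-1}+f_{i-2}$ (so $f_3=2$, $f_4=3$). The identity is between formal power series in $q$ with coefficients in $\mathbb{Z}[z,u]$. *)

theory Defs
  imports
    "HOL-Analysis.Analysis"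
    "HOL-Computational_Algebra.Computational_Algebra"
    "HOL-Number_Theory.Fib"
begin

definition is_partition :: "nat list \<Rightarrow> bool" where
  "is_partition xs \<longleftrightarrow> sorted_wrt (\<ge>) xs \<and> (\<forall>x\<in>set xs. 0 < x)"

text \<open>Entries are numbered from 1, as in \<open>\<lambda>\<^sub>1 \<ge> \<lambda>\<^sub>2 \<ge> \<dots>\<close>; missing entries are 0.
  The value at index 0 is irrelevant.\<close>

definition part :: "nat list \<Rightarrow> nat \<Rightarrow> nat" where
  "part xs j = (if 1 \<le> j \<and> j \<le> length xs then xs ! (j - 1) else 0)"

text \<open>For a profile \<open>(c\<^sub>1, c\<^sub>2)\<close> of rank two the conditions are
  that the first partition at \<open>j\<close>
  dominates the second at \<open>j + c\<^sub>2\<close>, and the second at \<open>j\<close> dominates the first at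
  \<open>j + c\<^sub>1\<close>: the shifts are crosswise.\<close>

definition cylindric_partitions :: "nat \<times> nat \<Rightarrow> (nat list \<times> nat list) set" where
  "cylindric_partitions c = {\<Lambda>. is_partition (fst \<Lambda>) \<and> is_partition (snd \<Lambda>) \<and>
     (\<forall>j\<ge>1. part (fst \<Lambda>) j \<ge> part (snd \<Lambda>) (j + snd c)) \<and>
     (\<forall>j\<ge>1. part (snd \<Lambda>) j \<ge> part (fst \<Lambda>) (j + fst c))}"

definition cyl_size :: "nat list \<times> nat list \<Rightarrow> nat" where
  "cyl_size \<Lambda> = sum_list (fst \<Lambda>) + sum_list (snd \<Lambda>)"

definition cyl_max :: "nat list \<times> nat list \<Rightarrow> nat" where
  "cyl_max \<Lambda> = Max (insert 0 (set (fst \<Lambda>) \<union> set (snd \<Lambda>)))"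

definition cyl_st :: "nat list \<times> nat list \<Rightarrow> nat" where
  "cyl_st \<Lambda> = card (set (fst \<Lambda>) \<union> set (snd \<Lambda>))"

text \<open>The coefficient ring of polynomials in \<open>z\<close> and \<open>u\<close> is represented as polynomials in
  \<open>u\<close> over polynomials in \<open>z\<close>. Infinite sums refer to the library metric on formal power
  series, i.e. to the \<open>q\<close>-adic topology.\<close>

type_synonym zu_series = "int poly poly fps"

definition q_var :: zu_series where
  "q_var = fps_X"

definition z_var :: zu_series where
  "z_var = fps_const [:[:0, 1:]:]"

definition u_var :: zu_series where
  "u_var = fps_const [:0, 1:]"

text \<open>The library division on formal power series needs a coefficient type of class
  \<open>inverse\<close>, which polynomials do not have. The one-sided inverse
  \<open>fps_right_inverse\<close> is available over every ring; here the constant coefficient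
  of the denominator is 1.\<close>

definition geom_factor :: "nat \<Rightarrow> zu_series" where
  "geom_factor j = u_var * z_var * q_var ^ j * fps_right_inverse (1 - z_var * q_var ^ j) 1"

lemma geom_factor_eq:
  assumes "0 < j"
  shows "geom_factor j * (1 - z_var * q_var ^ j) = u_var * z_var * q_var ^ j"
proof -
  have "(1 - z_var * q_var ^ j) * fps_right_inverse (1 - z_var * q_var ^ j) 1 = 1"
    using assms by (intro fps_right_inverse) (simp add: z_var_def q_var_def)
  then show ?thesis
    unfolding geom_factor_def by (simp add: mult.assoc mult.commute)
qed

definition inc_seqs :: "nat \<Rightarrow> nat list set" where
  "inc_seqs m = {js. length js = m \<and> sorted_wrt (<) js \<and> (\<forall>j\<in>set js. 0 < j)}"

fun first_run :: "nat list \<Rightarrow> nat" where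
  "first_run [] = 0"
| "first_run [j] = 1"
| "first_run (j # k # js) = (if k = Suc j then Suc (first_run (k # js)) else 1)"

lemma first_run_pos: "js \<noteq> [] \<Longrightarrow> 0 < first_run js"
  by (induction js rule: first_run.induct) auto

function run_lengths :: "nat list \<Rightarrow> nat list" where
  "run_lengths js =
     (if js = [] then [] else first_run js # run_lengths (drop (first_run js) js))"
  by pat_completeness auto
termination
  by (relation "Wellfounded.measure length") (auto simp: first_run_pos)

declare run_lengths.simps [simp del]

end

theory Submission
  imports Defs
begin

text \<open>
  For \<open>v \<ge> 1\<close> let \<open>(a, b)\<close> count the parts \<open>\<ge> v\<close> in the two partitions. A cylindric partition
  of profile \<open>(2, 1)\<close> is a weakly decreasing sequence (in \<open>v\<close>) of such level shapes, subject
  to \<open>- 1 \<le> a - b \<le> 2\<close>, that is, a strict chain of shapes \<open>\<noteq> (0, 0)\<close> with positive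
  multiplicities. The multiplicities add up to the largest part, the number of distinct shapes is
  the number of distinct parts, and a shape of weight \<open>j = a + b\<close> with multiplicity \<open>e\<close>
  contributes \<open>u z\<^sup>e q\<^sup>e\<^sup>j\<close>. Summing over the multiplicities turns a chain with weights
  \<open>j\<^sub>1 < \<dots> < j\<^sub>m\<close> into the product of the geometric factors, and the number of
  chains with these weights is the product of Fibonacci numbers.
\<close>

section \<open>Locally finite sums of formal power series\<close>

text \<open>Coefficientwise finiteness keeps the infinite sums below elementary: every coefficient
  of such a sum is a finite sum, and the condition passes to subsets, fibre sums and
  multiples.\<close>

definition locally_finite :: "('a \<Rightarrow> 'b::comm_ring_1 fps) \<Rightarrow> 'a set \<Rightarrow> bool" where
  "locally_finite f A \<longleftrightarrow> (\<forall>n. finite {x\<in>A. fps_nth (f x) n \<noteq> 0})"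

lemma locally_finite_subset:
  assumes "locally_finite f A" "B \<subseteq> A"
  shows "locally_finite f B"
  unfolding locally_finite_def
proof
  fix n
  have "finite {x\<in>A. fps_nth (f x) n \<noteq> 0}"
    using assms(1) by (simp add: locally_finite_def)
  then show "finite {x\<in>B. fps_nth (f x) n \<noteq> 0}"
    by (rule rev_finite_subset) (use assms(2) in blast)
qed

text \<open>Convergence means that each coefficient is eventually equal to that of the limit, and
  the \<open>n\<close>-th coefficient of a partial sum is settled once the index set contains the
  finite support \<open>?N\<close>.\<close>

lemma locally_finite_has_sum:
  assumes "locally_finite f A"
  shows "(f has_sum Abs_fps (\<lambda>n. \<Sum>x | x \<in> A \<and> fps_nth (f x) n \<noteq> 0. fps_nth (f x) n)) A"
  unfolding has_sum_def tendsto_fps_iff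
proof
  fix n
  let ?N = "{x\<in>A. fps_nth (f x) n \<noteq> 0}"
  have fin: "finite ?N"
    using assms by (simp add: locally_finite_def)
  have "fps_nth (sum f X) n = (\<Sum>x\<in>?N. fps_nth (f x) n)"
    if "finite X" "?N \<subseteq> X" "X \<subseteq> A" for X
    unfolding fps_sum_nth using that by (intro sum.mono_neutral_right) auto
  with fin show "\<forall>\<^sub>F X in finite_subsets_at_top A. fps_nth (sum f X) n =
      fps_nth (Abs_fps (\<lambda>n. \<Sum>x | x \<in> A \<and> fps_nth (f x) n \<noteq> 0. fps_nth (f x) n)) n"
    unfolding eventually_finite_subsets_at_top by (intro exI[of _ ?N]) auto
qed

lemma locally_finite_summable: "locally_finite f A \<Longrightarrow> f summable_on A"
  unfolding summable_on_def by (rule exI, rule locally_finite_has_sum)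

text \<open>\<open>F\<close> may be any finite superset of the support, so one set can serve several
  coefficients at once.\<close>

lemma infsum_nth:
  assumes "locally_finite f A" "finite F" "F \<subseteq> A"
    and "\<And>x. x \<in> A \<Longrightarrow> fps_nth (f x) n \<noteq> 0 \<Longrightarrow> x \<in> F"
  shows "fps_nth (infsum f A) n = (\<Sum>x\<in>F. fps_nth (f x) n)"
proof -
  have "fps_nth (infsum f A) n = (\<Sum>x | x \<in> A \<and> fps_nth (f x) n \<noteq> 0. fps_nth (f x) n)"
    by (simp add: infsumI[OF locally_finite_has_sum[OF assms(1)]])
  also have "\<dots> = (\<Sum>x\<in>F. fps_nth (f x) n)"
    using assms by (intro sum.mono_neutral_left) auto
  finally show ?thesis .
qed

lemma infsum_nth_support:
  assumes "locally_finite f A"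
  shows "fps_nth (infsum f A) n = (\<Sum>x | x \<in> A \<and> fps_nth (f x) n \<noteq> 0. fps_nth (f x) n)"
  using assms by (intro infsum_nth) (auto simp: locally_finite_def)

text \<open>Regrouping by the values of \<open>g\<close>. For a fixed coefficient only the fibres
  over the finite image of its support contribute, which reduces the claim to
  \<open>sum.group\<close>. Chains are later sorted in this way by length, weights, shapes and
  multiplicities.\<close>

lemma
  assumes lf: "locally_finite f A" and g: "g ` A \<subseteq> B"
  shows locally_finite_fibers: "locally_finite (\<lambda>y. infsum f {x\<in>A. g x = y}) B" (is ?lf)
    and infsum_fibers: "infsum f A = (\<Sum>\<^sub>\<infinity>y\<in>B. infsum f {x\<in>A. g x = y})" (is ?eq)
proof -
  let ?N = "\<lambda>n. {x\<in>A. fps_nth (f x) n \<noteq> 0}"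
  have fin: "finite (?N n)" for n
    using lf by (simp add: locally_finite_def)
  have inner: "fps_nth (infsum f {x\<in>A. g x = y}) n = (\<Sum>x\<in>{x\<in>?N n. g x = y}. fps_nth (f x) n)"
    for y n
  proof (rule infsum_nth[OF locally_finite_subset[OF lf]])
    show "finite {x\<in>?N n. g x = y}"
      by (rule finite_subset[OF _ fin]) auto
  qed auto
  have supp: "y \<in> g ` ?N n" if "fps_nth (infsum f {x\<in>A. g x = y}) n \<noteq> 0" for y n
  proof (rule ccontr)
    assume "y \<notin> g ` ?N n"
    then have "{x\<in>?N n. g x = y} = {}" by blast
    with that show False unfolding inner by (metis sum.empty)
  qed
  show lf': ?lf
    unfolding locally_finite_def
  proof
    fix n show "finite {y \<in> B. fps_nth (infsum f {x \<in> A. g x = y}) n \<noteq> 0}"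
      by (rule finite_subset[OF _ finite_imageI[OF fin, of g n]]) (use supp in auto)
  qed
  show ?eq
  proof (rule fps_ext)
    fix n
    have "fps_nth (\<Sum>\<^sub>\<infinity>y\<in>B. infsum f {x\<in>A. g x = y}) n
        = (\<Sum>y\<in>g ` ?N n. fps_nth (infsum f {x\<in>A. g x = y}) n)"
      by (rule infsum_nth[OF lf']) (use supp fin g in auto)
    also have "\<dots> = (\<Sum>x\<in>?N n. fps_nth (f x) n)"
      unfolding inner by (rule sum.group) (use fin in auto)
    also have "\<dots> = fps_nth (infsum f A) n"
      by (simp add: infsum_nth_support[OF lf])
    finally show "fps_nth (infsum f A) n = fps_nth (\<Sum>\<^sub>\<infinity>y\<in>B. infsum f {x\<in>A. g x = y}) n" ..
  qed
qed

text \<open>Coefficient \<open>n\<close> of \<open>c * f x\<close> involves only the coefficients of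
  \<open>f x\<close> up to \<open>n\<close>, so the union \<open>N n\<close> of their supports is a
  finite set containing all relevant indices.\<close>

lemma
  assumes lf: "locally_finite f A"
  shows locally_finite_cmult: "locally_finite (\<lambda>x. c * f x) A" (is ?lf)
    and infsum_cmult_locally_finite: "(\<Sum>\<^sub>\<infinity>x\<in>A. c * f x) = c * infsum f A" (is ?eq)
proof -
  define N where "N n = (\<Union>i\<le>n. {x\<in>A. fps_nth (f x) i \<noteq> 0})" for n
  have N: "finite (N n)" "N n \<subseteq> A" for n
    using lf by (auto simp: locally_finite_def N_def)
  have supp: "x \<in> N n" if "x \<in> A" "fps_nth (c * f x) n \<noteq> 0" for x n
  proof (rule ccontr)
    assume "x \<notin> N n"
    then have "fps_nth (f x) (n - i) = 0" for i
      using that(1) by (auto simp: N_def)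
    with that(2) show False by (simp add: fps_mult_nth)
  qed
  show lf': ?lf
    unfolding locally_finite_def
  proof
    fix n show "finite {x\<in>A. fps_nth (c * f x) n \<noteq> 0}"
      by (rule finite_subset[OF _ N(1)[of n]]) (use supp in auto)
  qed
  show ?eq
  proof (rule fps_ext)
    fix n
    have f: "fps_nth (infsum f A) (n - i) = (\<Sum>x\<in>N n. fps_nth (f x) (n - i))" for i
      by (rule infsum_nth[OF lf N]) (auto simp: N_def)
    have "fps_nth (\<Sum>\<^sub>\<infinity>x\<in>A. c * f x) n = (\<Sum>x\<in>N n. fps_nth (c * f x) n)"
      by (rule infsum_nth[OF lf' N supp])
    also have "\<dots> = fps_nth (c * infsum f A) n"
      unfolding fps_mult_nth f sum_distrib_left by (rule sum.swap)
    finally show "fps_nth (\<Sum>\<^sub>\<infinity>x\<in>A. c * f x) n = fps_nth (c * infsum f A) n" .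
  qed
qed

lemma infsum_insert_locally_finite:
  assumes lf: "locally_finite f (insert a A)" and "a \<notin> A"
  shows "infsum f (insert a A) = f a + infsum f A"
proof (rule fps_ext)
  fix n
  let ?N = "{x\<in>A. fps_nth (f x) n \<noteq> 0}"
  have lf': "locally_finite f A"
    using locally_finite_subset[OF lf] by blast
  have fin: "finite ?N"
    using lf' by (simp add: locally_finite_def)
  have "fps_nth (infsum f (insert a A)) n = (\<Sum>x\<in>insert a ?N. fps_nth (f x) n)"
    by (rule infsum_nth[OF lf]) (use fin in auto)
  also have "\<dots> = fps_nth (f a + infsum f A) n"
    using fin \<open>a \<notin> A\<close> by (simp add: infsum_nth_support[OF lf'])
  finally show "fps_nth (infsum f (insert a A)) n = fps_nth (f a + infsum f A) n" .
qed

section \<open>The geometric factor as a sum over multiplicities\<close>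

lemma fps_const_mult_X_power_nth:
  "fps_nth (fps_const (c::'a::comm_ring_1) * fps_X ^ m) n = (if n = m then c else 0)"
  by (simp add: fps_X_power_nth)

text \<open>Geometric series in \<open>x = z_var * q_var ^ j\<close>, where \<open>e\<close> is the
  multiplicity of a shape of weight \<open>j\<close>. Since \<open>0 < j\<close>, the power
  \<open>x ^ e\<close> can contribute to coefficient \<open>n\<close> only if
  \<open>e \<le> n\<close>.\<close>

lemma
  assumes "0 < j"
  shows locally_finite_geom: "locally_finite (\<lambda>e. u_var * z_var ^ e * q_var ^ (e * j)) {1..}" (is ?lf)
    and infsum_geom: "(\<Sum>\<^sub>\<infinity>e\<in>{1..}. u_var * z_var ^ e * q_var ^ (e * j)) = geom_factor j" (is ?eq)
proof -
  define x where "x = z_var * q_var ^ j"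
  have pow: "z_var ^ e * q_var ^ (e * j) = x ^ e" for e
    by (simp add: x_def power_mult_distrib mult.commute[of e j] power_mult)
  have supp: "n = e * j" if "fps_nth (x ^ e) n \<noteq> 0" for n e
    using that unfolding pow[symmetric] unfolding z_var_def q_var_def fps_const_power fps_const_mult_X_power_nth
    by (auto split: if_splits)
  have supp_le: "e \<le> n" if "fps_nth (x ^ e) n \<noteq> 0" for n e
    using supp[OF that] \<open>0 < j\<close> by simp
  have lf1: "locally_finite (\<lambda>e. x ^ e) UNIV"
    unfolding locally_finite_def
  proof
    fix n show "finite {e\<in>UNIV. fps_nth (x ^ e) n \<noteq> 0}"
      by (rule finite_subset[of _ "{..n}"]) (use supp_le in auto)
  qed
  then have lf0: "locally_finite (\<lambda>e. x ^ e) {1..}"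
    by (rule locally_finite_subset) simp
  let ?S = "\<Sum>\<^sub>\<infinity>e\<in>{1..}. x ^ e"
  \<comment> \<open>Splitting off \<open>e = 0\<close> and shifting the index yields the functional
    equation that determines the sum.\<close>
  have S: "x * (1 + ?S) = ?S"
  proof -
    have U: "UNIV = insert 0 {1::nat..}" by auto
    have "bij_betw Suc UNIV {1..}"
      by (rule bij_betwI[where g = "\<lambda>e. e - 1"]) auto
    then have "?S = (\<Sum>\<^sub>\<infinity>e\<in>UNIV. x ^ Suc e)"
      using infsum_reindex_bij_betw[of Suc UNIV "{1..}" "\<lambda>e. x ^ e"] by simp
    also have "\<dots> = x * (\<Sum>\<^sub>\<infinity>e\<in>UNIV. x ^ e)"
      using infsum_cmult_locally_finite[OF lf1, of x] by simp
    also have "(\<Sum>\<^sub>\<infinity>e\<in>UNIV. x ^ e) = 1 + ?S"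
      using infsum_insert_locally_finite[of "\<lambda>e. x ^ e" 0 "{1..}"] lf1 unfolding U by simp
    finally show ?thesis ..
  qed
  have e: "(\<lambda>e. u_var * z_var ^ e * q_var ^ (e * j)) = (\<lambda>e. u_var * x ^ e)"
    by (simp add: pow[symmetric] mult.assoc)
  show ?lf
    unfolding e by (rule locally_finite_cmult[OF lf0])
  have "?S * (1 - x) = x * (1 + ?S) - x * ?S"
    unfolding S by (simp add: algebra_simps)
  also have "\<dots> = x"
    by (simp add: algebra_simps)
  finally have "u_var * ?S * (1 - x) = u_var * x"
    by (simp only: mult.assoc)
  also have "\<dots> = geom_factor j * (1 - x)"
    using geom_factor_eq[OF \<open>0 < j\<close>] by (simp add: x_def mult.assoc)
  \<comment> \<open>The common factor is cancelled in an integral domain; the constant coefficient 1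
    excludes \<open>1 - x = 0\<close>.\<close>
  finally have "u_var * ?S = geom_factor j \<or> 1 - x = 0"
    by auto
  moreover have "fps_nth (1 - x) 0 = 1"
    using \<open>0 < j\<close> by (simp add: x_def q_var_def)
  then have "1 - x \<noteq> 0" by auto
  ultimately show ?eq
    unfolding e infsum_cmult_locally_finite[OF lf0] by blast
qed

section \<open>Counting chains of shapes by weights\<close>

type_synonym shape = "nat \<times> nat"

definition shapes :: "shape set" where
  "shapes = {(a, b). a \<le> b + 2 \<and> b \<le> a + 1 \<and> 0 < a + b}"

definition weight :: "shape \<Rightarrow> nat" where
  "weight p = fst p + snd p"

definition shape_less :: "shape \<Rightarrow> shape \<Rightarrow> bool" where
  "shape_less p p' \<longleftrightarrow> fst p \<le> fst p' \<and> snd p \<le> snd p' \<and> p \<noteq> p'"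

definition shape_chains :: "nat list \<Rightarrow> shape list set" where
  "shape_chains js = {ps. map weight ps = js \<and> set ps \<subseteq> shapes \<and> sorted_wrt shape_less ps}"

text \<open>For every weight there are exactly two shapes. Between consecutive weights, only the
  step from a bad shape to a bad shape is forbidden, so the states along a run of length \<open>r\<close>
  are words without two adjacent bad letters, counted by \<open>fib (r + 2)\<close>. A shape \<open>(a, b)\<close> is
  bad iff \<open>a - b\<close> is extremal, i.e. \<open>2\<close> or \<open>- 1\<close>.\<close>

definition good_shape :: "nat \<Rightarrow> shape" where
  "good_shape j = (Suc j div 2, j div 2)"

definition bad_shape :: "nat \<Rightarrow> shape" where
  "bad_shape j = (if even j then (Suc (j div 2), j div 2 - 1) else (j div 2, Suc (j div 2)))"

lemma good_neq_bad: "good_shape j \<noteq> bad_shape j"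
  by (auto simp: good_shape_def bad_shape_def)

text \<open>The difference \<open>a - b\<close> has the parity of \<open>j = a + b\<close> and lies
  between -1 and 2. This leaves 0 and 2 for even \<open>j\<close>, and 1 and -1 for odd
  \<open>j\<close>, the good value first in each case.\<close>

lemma weight_shape:
  assumes "0 < j"
  shows "p \<in> shapes \<and> weight p = j \<longleftrightarrow> p = good_shape j \<or> p = bad_shape j"
proof -
  obtain a b where p: "p = (a, b)" by (cases p)
  obtain h where "j = 2 * h \<or> j = Suc (2 * h)"
    by (metis evenE oddE Suc_eq_plus1)
  then show ?thesis
    using assms unfolding p shapes_def weight_def good_shape_def bad_shape_def
    by (elim disjE) (simp_all, arith+)
qed

text \<open>Write \<open>d\<close> and \<open>d'\<close> for the differences of the coordinates of
  \<open>p\<close> and \<open>p'\<close>. Then \<open>p\<close> lies below \<open>p'\<close> iff the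
  distance of \<open>d\<close> and \<open>d'\<close> is at most \<open>k - j\<close>. By parity this
  distance is 1 or 3 for consecutive weights, and 3 occurs exactly between the extremal values 2 and
  -1; for larger gaps the bound always holds.\<close>

lemma shape_less_iff:
  assumes "0 < j" "j < k" "p \<in> {good_shape j, bad_shape j}" "p' \<in> {good_shape k, bad_shape k}"
  shows "shape_less p p' \<longleftrightarrow> \<not> (k = Suc j \<and> p = bad_shape j \<and> p' = bad_shape k)"
proof -
  obtain h where h: "j = 2 * h \<or> j = Suc (2 * h)"
    by (metis evenE oddE Suc_eq_plus1)
  obtain i where i: "k = 2 * i \<or> k = Suc (2 * i)"
    by (metis evenE oddE Suc_eq_plus1)
  show ?thesis
    using h i assms unfolding shape_less_def good_shape_def bad_shape_def
    by (elim disjE insertE emptyE) (simp_all, arith+)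
qed

section \<open>Recursion and Fibonacci count for shape chains\<close>

lemma transp_shape_less: "transp shape_less"
  by (rule transpI) (auto simp: shape_less_def prod_eq_iff)

lemma shape_chains_Nil: "shape_chains [] = {[]}"
  by (auto simp: shape_chains_def)

lemma Nil_notin_shape_chains: "[] \<notin> shape_chains (j # js)"
  by (simp add: shape_chains_def)

text \<open>By transitivity only the comparison with the next shape matters, so chains can be
  counted by a two-state recursion.\<close>

lemma Cons_mem_shape_chains:
  assumes "0 < j"
  shows "p # ps \<in> shape_chains (j # js) \<longleftrightarrow> p \<in> {good_shape j, bad_shape j} \<and>
    ps \<in> shape_chains js \<and> (ps = [] \<or> shape_less p (hd ps))"
proof -
  have "sorted_wrt shape_less (p # ps) \<longleftrightarrow>
      sorted_wrt shape_less ps \<and> (ps = [] \<or> shape_less p (hd ps))"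
    using transp_shape_less by (cases ps) (auto dest: transpD)
  then have "p # ps \<in> shape_chains (j # js) \<longleftrightarrow> (p \<in> shapes \<and> weight p = j) \<and>
      ps \<in> shape_chains js \<and> (ps = [] \<or> shape_less p (hd ps))"
    unfolding shape_chains_def mem_Collect_eq by auto
  then show ?thesis
    using weight_shape[OF assms] by simp
qed

lemma shape_chains_Cons:
  assumes "0 < j"
  shows "shape_chains (j # js) = {p # ps |p ps. p \<in> {good_shape j, bad_shape j} \<and>
    ps \<in> shape_chains js \<and> (ps = [] \<or> shape_less p (hd ps))}" (is "_ = ?R")
proof (rule set_eqI)
  fix qs show "qs \<in> shape_chains (j # js) \<longleftrightarrow> qs \<in> ?R"
    by (cases qs) (auto simp: Nil_notin_shape_chains Cons_mem_shape_chains[OF assms] simp del: split_paired_Ex)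
qed

lemma shape_chains_Cons_hd:
  assumes "0 < k" "ps \<in> shape_chains (k # js)"
  shows "ps \<noteq> [] \<and> hd ps \<in> {good_shape k, bad_shape k}"
  using assms(2) by (auto simp: shape_chains_Cons[OF assms(1)])

lemma finite_shape_chains: "\<forall>j\<in>set js. 0 < j \<Longrightarrow> finite (shape_chains js)"
proof (induction js)
  case (Cons j js)
  then have "finite ((\<lambda>(p, ps). p # ps) ` ({good_shape j, bad_shape j} \<times> shape_chains js))"
    by simp
  then show ?case
    by (rule rev_finite_subset) (use Cons.prems in \<open>auto simp: shape_chains_Cons\<close>)
qed (simp add: shape_chains_Nil)

text \<open>The count is refined by the first shape to make the induction work. Inside a run a good
  shape can precede every chain of the tail and a bad one only those starting with a good shape,
  which is the Fibonacci recursion. At the end of a run no restriction crosses the gap, so the count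
  of the remaining chains splits off as a factor.\<close>

lemma card_shape_chains_run:
  assumes "js \<noteq> []" "sorted_wrt (<) js" "\<forall>j\<in>set js. 0 < j"
  shows "card {ps\<in>shape_chains js. hd ps = good_shape (hd js)}
           = fib (Suc (first_run js)) * card (shape_chains (drop (first_run js) js))
       \<and> card {ps\<in>shape_chains js. hd ps = bad_shape (hd js)}
           = fib (first_run js) * card (shape_chains (drop (first_run js) js))
       \<and> card (shape_chains js)
           = fib (2 + first_run js) * card (shape_chains (drop (first_run js) js))"
  using assms
proof (induction js rule: first_run.induct)
  case (2 j)
  then have "shape_chains [j] = {[good_shape j], [bad_shape j]}"
    by (auto simp: shape_chains_Cons shape_chains_Nil simp del: split_paired_Ex)
  moreover have "{ps\<in>{[good_shape j], [bad_shape j]}. hd ps = good_shape j} = {[good_shape j]}"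
    "{ps\<in>{[good_shape j], [bad_shape j]}. hd ps = bad_shape j} = {[bad_shape j]}"
    using good_neq_bad[of j] by auto
  ultimately show ?case
    using good_neq_bad[of j] by (simp add: shape_chains_Nil numeral_3_eq_3)
next
  case (3 j k js)
  let ?C = "shape_chains (k # js)"
  let ?good = "{ps\<in>shape_chains (j # k # js). hd ps = good_shape j}"
  let ?bad = "{ps\<in>shape_chains (j # k # js). hd ps = bad_shape j}"
  have jk: "0 < j" "0 < k" "j < k" using 3 by auto
  note less = shape_less_iff[OF jk(1,3)]
  have fin: "finite (shape_chains (j # k # js))"
    by (rule finite_shape_chains) (use 3 in auto)
  have less_hd: "ps \<noteq> []" "shape_less (good_shape j) (hd ps)"
      "shape_less (bad_shape j) (hd ps) \<longleftrightarrow> (k = Suc j \<longrightarrow> hd ps = good_shape k)"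
    if "ps \<in> ?C" for ps
    using shape_chains_Cons_hd[OF jk(2) that] less[of _ "hd ps"] good_neq_bad[of j] good_neq_bad[of k]
    by auto
  have good: "?good = (#) (good_shape j) ` ?C"
  proof (rule set_eqI)
    fix qs show "qs \<in> ?good \<longleftrightarrow> qs \<in> (#) (good_shape j) ` ?C"
      using less_hd by (cases qs) (auto simp: Cons_mem_shape_chains[OF jk(1)] Nil_notin_shape_chains)
  qed
  have bad: "?bad = (#) (bad_shape j) ` {ps\<in>?C. k = Suc j \<longrightarrow> hd ps = good_shape k}"
  proof (rule set_eqI)
    fix qs show "qs \<in> ?bad \<longleftrightarrow>
        qs \<in> (#) (bad_shape j) ` {ps\<in>?C. k = Suc j \<longrightarrow> hd ps = good_shape k}"
    proof (cases qs)
      case (Cons p ps)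
      then show ?thesis
        using less_hd[of ps] by (auto simp: Cons_mem_shape_chains[OF jk(1)])
    qed (auto simp: Nil_notin_shape_chains)
  qed
  have cg: "card ?good = card ?C"
    unfolding good by (rule card_image) simp
  have cb: "card ?bad = card {ps\<in>?C. k = Suc j \<longrightarrow> hd ps = good_shape k}"
    unfolding bad by (rule card_image) simp
  have "shape_chains (j # k # js) = ?good \<union> ?bad"
    by (auto simp: shape_chains_Cons[OF jk(1)] simp del: split_paired_Ex)
  then have "card (shape_chains (j # k # js)) = card (?good \<union> ?bad)" by simp
  also have "\<dots> = card ?good + card ?bad"
    by (rule card_Un_disjoint) (use fin good_neq_bad[of j] in auto)
  finally have total: "card (shape_chains (j # k # js)) = card ?good + card ?bad" .
  show ?case
  proof (cases "k = Suc j")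
    case True
    have IH: "card {ps\<in>?C. hd ps = good_shape k}
             = fib (Suc (first_run (k # js))) * card (shape_chains (drop (first_run (k # js)) (k # js)))"
         "card ?C = fib (2 + first_run (k # js)) * card (shape_chains (drop (first_run (k # js)) (k # js)))"
      using 3(1)[OF True] 3 by simp_all
    with True show ?thesis
      using cg cb total by (simp add: add_mult_distrib)
  next
    \<comment> \<open>A gap follows \<open>j\<close>: both first shapes extend every chain of the
      tail, with factors \<open>fib 2 = 1\<close>, \<open>fib 1 = 1\<close> and
      \<open>fib 3 = 2\<close>.\<close>
    case False
    then show ?thesis
      using cg cb total by (simp add: numeral_3_eq_3)
  qed
qed simp

lemma card_shape_chains:
  assumes "sorted_wrt (<) js" "\<forall>j\<in>set js. 0 < j"
  shows "card (shape_chains js) = (\<Prod>r\<leftarrow>run_lengths js. fib (2 + r))"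
  using assms
proof (induction js rule: run_lengths.induct)
  case (1 js)
  show ?case
  proof (cases "js = []")
    case True
    then show ?thesis by (simp add: shape_chains_Nil run_lengths.simps)
  next
    case False
    have "card (shape_chains (drop (first_run js) js))
        = (\<Prod>r\<leftarrow>run_lengths (drop (first_run js) js). fib (2 + r))"
      using 1 False by (auto intro: sorted_wrt_drop dest: in_set_dropD)
    then show ?thesis
      using card_shape_chains_run[OF False "1.prems"] False
      by (subst run_lengths.simps) simp
  qed
qed

section \<open>Cylindric partitions as chains with multiplicities\<close>

definition raise_parts :: "nat \<Rightarrow> nat \<Rightarrow> nat list \<Rightarrow> nat list" where
  "raise_parts a e xs = map (\<lambda>x. x + e) xs @ replicate (a - length xs) e"

text \<open>The filter removes the entries that subtraction would turn into 0, since 0 is not a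
  part.\<close>

definition lower_parts :: "nat \<Rightarrow> nat list \<Rightarrow> nat list" where
  "lower_parts e xs = map (\<lambda>x. x - e) (filter (\<lambda>x. e < x) xs)"

lemma lower_raise_parts: "\<forall>x\<in>set xs. 0 < x \<Longrightarrow> lower_parts e (raise_parts a e xs) = xs"
  unfolding lower_parts_def raise_parts_def by (induction xs) auto

lemma length_lower_parts: "length (lower_parts e xs) \<le> length xs"
  by (simp add: lower_parts_def)

lemma length_lower_parts_less: "e \<in> set xs \<Longrightarrow> length (lower_parts e xs) < length xs"
  by (simp add: lower_parts_def length_filter_less)

lemma raise_lower_parts:
  assumes "sorted_wrt (\<ge>) xs" "\<forall>x\<in>set xs. e \<le> x"
  shows "raise_parts (length xs) e (lower_parts e xs) = xs"
  using assms
proof (induction xs)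
  case (Cons x xs)
  show ?case
  proof (cases "e < x")
    case True
    then show ?thesis
      using Cons by (simp add: raise_parts_def lower_parts_def)
  next
    case False
    \<comment> \<open>Sortedness bounds all entries by \<open>x \<le> e\<close>, and
      \<open>e\<close> is also a lower bound.\<close>
    then have "\<forall>y\<in>set (x # xs). y = e"
      using Cons.prems by force
    then have "x # xs = replicate (length (x # xs)) e"
      by (metis replicate_eqI)
    moreover have "lower_parts e (x # xs) = []"
      using \<open>\<forall>y\<in>set (x # xs). y = e\<close> by (auto simp: lower_parts_def)
    ultimately show ?thesis
      by (simp add: raise_parts_def)
  qed
qed (simp add: raise_parts_def lower_parts_def)

lemma length_raise_parts: "length xs \<le> a \<Longrightarrow> length (raise_parts a e xs) = a"
  by (simp add: raise_parts_def)

lemma is_partition_raise_parts: "is_partition xs \<Longrightarrow> 0 < e \<Longrightarrow> is_partition (raise_parts a e xs)"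
proof -
  have "sorted_wrt (\<ge>) (replicate n e)" for n
    by (induction n) auto
  then show "is_partition xs \<Longrightarrow> 0 < e \<Longrightarrow> is_partition (raise_parts a e xs)"
    by (auto simp: is_partition_def raise_parts_def sorted_wrt_append sorted_wrt_map)
qed

lemma is_partition_lower_parts: "is_partition xs \<Longrightarrow> is_partition (lower_parts e xs)"
  unfolding is_partition_def lower_parts_def
  by (induction xs) (auto intro: diff_le_mono)

text \<open>Missing entries count as 0, so the padding is raised like every other entry and one
  formula covers all positions up to \<open>a\<close>.\<close>

lemma part_raise_parts:
  assumes "length xs \<le> a"
  shows "part (raise_parts a e xs) j = (if 1 \<le> j \<and> j \<le> a then part xs j + e else 0)"
  using assms by (auto simp: part_def raise_parts_def nth_append)

lemma part_Cons: "part (x # xs) j = (if j = 1 then x else if j = 0 then 0 else part xs (j - 1))"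
  by (auto simp: part_def nth_Cons' )

lemma part_Nil: "part [] j = 0"
  by (simp add: part_def)

lemma part_le: "\<forall>x\<in>set xs. x \<le> e \<Longrightarrow> part xs j \<le> e"
  by (auto simp: part_def)

text \<open>In a weakly decreasing list the filter keeps a prefix, so no index moves; for the
  dropped entries truncated subtraction gives 0 as well.\<close>

lemma part_lower_parts:
  assumes "is_partition xs"
  shows "part (lower_parts e xs) j = part xs j - e"
  using assms
proof (induction xs arbitrary: j)
  case (Cons x xs)
  then have IH: "part (lower_parts e xs) i = part xs i - e" for i
    by (auto simp: is_partition_def)
  show ?case
  proof (cases "e < x")
    case True
    then have "lower_parts e (x # xs) = (x - e) # lower_parts e xs"
      by (simp add: lower_parts_def)
    then show ?thesis by (simp add: part_Cons IH)
  next
    case False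
    then have "\<forall>y\<in>set (x # xs). y \<le> e"
      using Cons.prems by (auto simp: is_partition_def)
    then have "filter (\<lambda>x. e < x) (x # xs) = []"
      unfolding filter_empty_conv by (simp add: not_less)
    then have "lower_parts e (x # xs) = []"
      by (simp only: lower_parts_def list.map)
    moreover have "part (x # xs) j \<le> e"
      by (rule part_le) fact
    ultimately show ?thesis by (simp add: part_Nil)
  qed
qed (simp add: lower_parts_def part_Nil)

lemma set_raise_parts:
  "length xs \<le> a \<Longrightarrow>
    set (raise_parts a e xs) = (\<lambda>x. x + e) ` set xs \<union> (if length xs < a then {e} else {})"
  by (auto simp: raise_parts_def)

lemma sum_list_raise_parts:
  assumes "length xs \<le> a"
  shows "sum_list (raise_parts a e xs) = sum_list xs + e * a"
proof -
  have "sum_list (raise_parts a e xs) = sum_list xs + e * length xs + e * (a - length xs)"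
    by (simp add: raise_parts_def sum_list_addf sum_list_triv sum_list_replicate)
  also have "\<dots> = sum_list xs + e * a"
    using assms by (simp add: add_mult_distrib2[symmetric] add.assoc)
  finally show ?thesis .
qed

lemma part_pos_iff: "is_partition xs \<Longrightarrow> 0 < part xs j \<longleftrightarrow> 1 \<le> j \<and> j \<le> length xs"
  by (auto simp: is_partition_def part_def)

section \<open>Bottom levels of a cylindric partition\<close>

lemma cylindric_21:
  "(xs, ys) \<in> cylindric_partitions (2, 1) \<longleftrightarrow> is_partition xs \<and> is_partition ys \<and>
     (\<forall>j\<ge>1. part ys (j + 1) \<le> part xs j) \<and> (\<forall>j\<ge>1. part xs (j + 2) \<le> part ys j)"
  by (simp add: cylindric_partitions_def)

text \<open>The shape records how many entries of each partition are positive; \<open>inflate p e\<close> puts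
  \<open>e\<close> further levels of shape \<open>p\<close> underneath, so \<open>e\<close> becomes the smallest part.\<close>

definition cyl_shape :: "nat list \<times> nat list \<Rightarrow> shape" where
  "cyl_shape \<Lambda> = (length (fst \<Lambda>), length (snd \<Lambda>))"

definition inflate :: "shape \<Rightarrow> nat \<Rightarrow> nat list \<times> nat list \<Rightarrow> nat list \<times> nat list" where
  "inflate p e \<Lambda> = (raise_parts (fst p) e (fst \<Lambda>), raise_parts (snd p) e (snd \<Lambda>))"

definition deflate :: "nat \<Rightarrow> nat list \<times> nat list \<Rightarrow> nat list \<times> nat list" where
  "deflate e \<Lambda> = (lower_parts e (fst \<Lambda>), lower_parts e (snd \<Lambda>))"

text \<open>Each length bound is the cylindric inequality evaluated just past the end of the
  dominating partition, where its entry is 0.\<close>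

lemma cyl_shape_mem_shapes:
  assumes "\<Lambda> \<in> cylindric_partitions (2, 1)" "\<Lambda> \<noteq> ([], [])"
  shows "cyl_shape \<Lambda> \<in> shapes"
proof -
  obtain xs ys where \<Lambda>: "\<Lambda> = (xs, ys)" by (cases \<Lambda>)
  have parts: "is_partition xs" "is_partition ys"
    and cyl: "\<And>j. 1 \<le> j \<Longrightarrow> part ys (j + 1) \<le> part xs j"
      "\<And>j. 1 \<le> j \<Longrightarrow> part xs (j + 2) \<le> part ys j"
    using assms(1) unfolding \<Lambda> cylindric_21 by blast+
  have "length ys \<le> length xs + 1"
  proof (rule ccontr)
    assume "\<not> ?thesis"
    then have "0 < part ys (length xs + 1 + 1)"
      using parts by (simp add: part_pos_iff)
    also have "\<dots> \<le> part xs (length xs + 1)"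
      by (rule cyl) simp
    finally show False using parts by (simp add: part_pos_iff)
  qed
  moreover have "length xs \<le> length ys + 2"
  proof (rule ccontr)
    assume "\<not> ?thesis"
    then have "0 < part xs (length ys + 1 + 2)"
      using parts by (simp add: part_pos_iff)
    also have "\<dots> \<le> part ys (length ys + 1)"
      by (rule cyl) simp
    finally show False using parts by (simp add: part_pos_iff)
  qed
  ultimately show ?thesis
    using assms(2) by (simp add: \<Lambda> cyl_shape_def shapes_def)
qed

text \<open>The bounds defining \<open>shapes\<close> ensure that whenever the dominated entry is a
  raised one, so is the dominating entry; then both sides grow by \<open>e\<close>. Strictness of
  \<open>shape_less\<close> forces at least one padding entry, so \<open>e\<close> really occurs and
  is a new smallest part.\<close>

lemma inflate:
  assumes \<Lambda>: "\<Lambda> \<in> cylindric_partitions (2, 1)"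
    and p: "p \<in> shapes" "shape_less (cyl_shape \<Lambda>) p" and e: "0 < e"
  shows "inflate p e \<Lambda> \<in> cylindric_partitions (2, 1)"
    and "cyl_shape (inflate p e \<Lambda>) = p"
    and "cyl_size (inflate p e \<Lambda>) = cyl_size \<Lambda> + e * weight p"
    and "cyl_max (inflate p e \<Lambda>) = cyl_max \<Lambda> + e"
    and "cyl_st (inflate p e \<Lambda>) = Suc (cyl_st \<Lambda>)"
    and "Min (set (fst (inflate p e \<Lambda>)) \<union> set (snd (inflate p e \<Lambda>))) = e"
    and "deflate e (inflate p e \<Lambda>) = \<Lambda>"
proof -
  obtain xs ys a b where eqs: "\<Lambda> = (xs, ys)" "p = (a, b)"
    by (cases \<Lambda>; cases p)
  have parts: "is_partition xs" "is_partition ys"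
    and cyl: "\<And>j. 1 \<le> j \<Longrightarrow> part ys (j + 1) \<le> part xs j"
      "\<And>j. 1 \<le> j \<Longrightarrow> part xs (j + 2) \<le> part ys j"
    using \<Lambda> unfolding eqs cylindric_21 by blast+
  have len: "length xs \<le> a" "length ys \<le> b" "length xs < a \<or> length ys < b"
    and ab: "a \<le> b + 2" "b \<le> a + 1"
    using p by (auto simp: eqs cyl_shape_def shape_less_def shapes_def)
  have infl: "inflate p e \<Lambda> = (raise_parts a e xs, raise_parts b e ys)"
    by (simp add: eqs inflate_def)
  show "inflate p e \<Lambda> \<in> cylindric_partitions (2, 1)"
    unfolding infl cylindric_21
    using parts e cyl ab by (auto simp: is_partition_raise_parts part_raise_parts len)
  show "cyl_shape (inflate p e \<Lambda>) = p"
    unfolding infl by (simp add: cyl_shape_def length_raise_parts len eqs)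
  show "cyl_size (inflate p e \<Lambda>) = cyl_size \<Lambda> + e * weight p"
    unfolding infl by (simp add: cyl_size_def sum_list_raise_parts len eqs weight_def algebra_simps)
  let ?P = "set xs \<union> set ys"
  \<comment> \<open>The inserted 0 stands for the padding entries, which become \<open>e\<close>.
    Because 0 is not in \<open>?P\<close>, it accounts for the one additional distinct part.\<close>
  have set: "set (fst (inflate p e \<Lambda>)) \<union> set (snd (inflate p e \<Lambda>)) = (\<lambda>x. x + e) ` insert 0 ?P"
    unfolding infl using len(3) by (auto simp: set_raise_parts len(1,2))
  have pos: "0 \<notin> ?P"
    using parts by (auto simp: is_partition_def)
  have "Max (insert 0 ((\<lambda>x. x + e) ` insert 0 ?P)) = Max ((\<lambda>x. x + e) ` insert 0 ?P)"
    by simp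
  also have "\<dots> = Max (insert 0 ?P) + e"
    by (rule mono_Max_commute[where f = "\<lambda>x. x + e", symmetric]) (auto intro: monoI)
  finally show "cyl_max (inflate p e \<Lambda>) = cyl_max \<Lambda> + e"
    unfolding cyl_max_def set by (simp add: eqs)
  show "cyl_st (inflate p e \<Lambda>) = Suc (cyl_st \<Lambda>)"
    unfolding cyl_st_def set using pos by (subst card_image) (simp_all add: eqs)
  show "Min (set (fst (inflate p e \<Lambda>)) \<union> set (snd (inflate p e \<Lambda>))) = e"
    unfolding set by (rule Min_eqI) auto
  show "deflate e (inflate p e \<Lambda>) = \<Lambda>"
    unfolding infl deflate_def using parts by (simp add: lower_raise_parts is_partition_def eqs)
qed

text \<open>The inverse step: subtraction is monotone and preserves the cylindric inequalities, and
  an entry equal to the minimum \<open>e\<close> disappears, so the shape strictly shrinks.\<close>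

lemma deflate_Min:
  assumes \<Lambda>: "\<Lambda> \<in> cylindric_partitions (2, 1)" "\<Lambda> \<noteq> ([], [])"
    and e_def: "e = Min (set (fst \<Lambda>) \<union> set (snd \<Lambda>))"
  shows "0 < e"
    and "deflate e \<Lambda> \<in> cylindric_partitions (2, 1)"
    and "shape_less (cyl_shape (deflate e \<Lambda>)) (cyl_shape \<Lambda>)"
    and "inflate (cyl_shape \<Lambda>) e (deflate e \<Lambda>) = \<Lambda>"
proof -
  obtain xs ys where eqs: "\<Lambda> = (xs, ys)" by (cases \<Lambda>)
  have parts: "is_partition xs" "is_partition ys"
    and cyl: "\<And>j. 1 \<le> j \<Longrightarrow> part ys (j + 1) \<le> part xs j"
      "\<And>j. 1 \<le> j \<Longrightarrow> part xs (j + 2) \<le> part ys j"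
    using \<Lambda> unfolding eqs cylindric_21 by blast+
  have e: "e \<in> set xs \<union> set ys"
    unfolding e_def eqs fst_conv snd_conv using \<Lambda>(2) eqs by (intro Min_in) auto
  then show "0 < e"
    using parts by (auto simp: is_partition_def)
  have e_le: "\<forall>x\<in>set xs. e \<le> x" "\<forall>y\<in>set ys. e \<le> y"
    unfolding e_def eqs by auto
  show "deflate e \<Lambda> \<in> cylindric_partitions (2, 1)"
    unfolding eqs deflate_def fst_conv snd_conv cylindric_21
    using parts cyl by (auto simp: is_partition_lower_parts part_lower_parts intro: diff_le_mono)
  show "shape_less (cyl_shape (deflate e \<Lambda>)) (cyl_shape \<Lambda>)"
    using e length_lower_parts[of e xs] length_lower_parts[of e ys]
      length_lower_parts_less[of e xs] length_lower_parts_less[of e ys]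
    by (auto simp: eqs deflate_def cyl_shape_def shape_less_def)
  show "inflate (cyl_shape \<Lambda>) e (deflate e \<Lambda>) = \<Lambda>"
    using parts e_le
    by (simp add: eqs deflate_def cyl_shape_def inflate_def raise_lower_parts is_partition_def)
qed

section \<open>The bijection with weighted chains\<close>

definition weighted_chains :: "(shape \<times> nat) list set" where
  "weighted_chains = {c. sorted_wrt shape_less (map fst c) \<and> set (map fst c) \<subseteq> shapes \<and>
     (\<forall>x\<in>set c. 0 < snd x)}"

text \<open>Shapes grow downwards, so the chain lists the top levels first and each
  \<open>inflate\<close> places its levels below those already present.\<close>

definition assemble :: "(shape \<times> nat) list \<Rightarrow> nat list \<times> nat list" where
  "assemble c = fold (\<lambda>(p, e). inflate p e) c ([], [])"

lemma assemble_Nil: "assemble [] = ([], [])"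
  by (simp add: assemble_def)

lemma assemble_snoc: "assemble (c @ [(p, e)]) = inflate p e (assemble c)"
  by (simp add: assemble_def)

lemma weighted_chains_snoc:
  "c @ [(p, e)] \<in> weighted_chains \<longleftrightarrow>
     c \<in> weighted_chains \<and> p \<in> shapes \<and> 0 < e \<and> (\<forall>x\<in>set c. shape_less (fst x) p)"
  by (auto simp: weighted_chains_def sorted_wrt_append)

lemma shape_less_origin: "p \<in> shapes \<Longrightarrow> shape_less (0, 0) p"
  by (auto simp: shape_less_def shapes_def)

text \<open>The induction runs from the right because the last pair is the bottom level. The claim
  about \<open>cyl_shape\<close> supplies the comparison that \<open>inflate\<close>
  requires.\<close>

lemma assemble:
  assumes "c \<in> weighted_chains"
  shows "assemble c \<in> cylindric_partitions (2, 1)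
       \<and> cyl_shape (assemble c) = (if c = [] then (0, 0) else fst (last c))
       \<and> cyl_size (assemble c) = (\<Sum>x\<leftarrow>c. snd x * weight (fst x))
       \<and> cyl_max (assemble c) = (\<Sum>x\<leftarrow>c. snd x)
       \<and> cyl_st (assemble c) = length c"
  using assms
proof (induction c rule: rev_induct)
  case Nil
  have "([], []) \<in> cylindric_partitions (2, 1)"
    unfolding cylindric_21 by (simp add: is_partition_def part_Nil)
  then show ?case
    by (simp add: assemble_Nil cyl_shape_def cyl_size_def cyl_max_def cyl_st_def)
next
  case (snoc pe c)
  obtain p e where pe: "pe = (p, e)" by (cases pe)
  have c: "c \<in> weighted_chains" "p \<in> shapes" "0 < e" "\<forall>x\<in>set c. shape_less (fst x) p"
    using snoc.prems unfolding pe weighted_chains_snoc by auto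
  note IH = snoc.IH[OF c(1)]
  have "shape_less (cyl_shape (assemble c)) p"
    using IH c shape_less_origin by simp
  from inflate[OF _ c(2) this c(3)] IH show ?case
    by (simp add: pe assemble_snoc)
qed

lemma weighted_chains_shape_less:
  assumes "c @ [(p, e)] \<in> weighted_chains"
  shows "shape_less (cyl_shape (assemble c)) p"
  using assms assemble[of c] shape_less_origin by (auto simp: weighted_chains_snoc)

text \<open>\<open>p\<close> is recovered as the shape, \<open>e\<close> as the smallest part, and
  the rest by deflation.\<close>

lemma inflate_inject:
  assumes "\<Lambda> \<in> cylindric_partitions (2, 1)" "p \<in> shapes" "shape_less (cyl_shape \<Lambda>) p" "0 < e"
    and "\<Lambda>' \<in> cylindric_partitions (2, 1)" "p' \<in> shapes" "shape_less (cyl_shape \<Lambda>') p'" "0 < e'"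
    and "inflate p e \<Lambda> = inflate p' e' \<Lambda>'"
  shows "p = p' \<and> e = e' \<and> \<Lambda> = \<Lambda>'"
proof -
  have "p = p'"
    using inflate(2)[OF assms(1-4)] inflate(2)[OF assms(5-8)] assms(9) by simp
  moreover have e: "e = e'"
    using inflate(6)[OF assms(1-4)] inflate(6)[OF assms(5-8)] assms(9) by simp
  moreover have "\<Lambda> = \<Lambda>'"
    using inflate(7)[OF assms(1-4)] inflate(7)[OF assms(5-8)] assms(9) e by simp
  ultimately show ?thesis by blast
qed

lemma assemble_eq_Nil:
  assumes "c \<in> weighted_chains" "assemble c = ([], [])"
  shows "c = []"
proof (rule ccontr)
  assume "c \<noteq> []"
  then have "fst (last c) = (0, 0)"
    using assemble[OF assms(1)] assms(2) by (simp add: cyl_shape_def)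
  moreover have "fst (last c) \<in> shapes"
    using assms(1) last_in_set[OF \<open>c \<noteq> []\<close>] by (auto simp: weighted_chains_def)
  ultimately show False by (simp add: shapes_def)
qed

lemma inj_on_assemble: "inj_on assemble weighted_chains"
proof (rule inj_onI)
  fix c c' assume "c \<in> weighted_chains" "c' \<in> weighted_chains" "assemble c = assemble c'"
  then show "c = c'"
  proof (induction c arbitrary: c' rule: rev_induct)
    case Nil
    then show ?case using assemble_eq_Nil[of c'] by (simp add: assemble_Nil)
  next
    case (snoc pe c)
    obtain p e where pe: "pe = (p, e)" by (cases pe)
    show ?case
    proof (cases c' rule: rev_cases)
      case Nil
      then show ?thesis
        using snoc.prems assemble_eq_Nil[of "c @ [pe]"] by (simp add: assemble_Nil)
    next
      case c': (snoc d pe')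
      obtain p' e' where pe': "pe' = (p', e')" by (cases pe')
      have wc: "c @ [(p, e)] \<in> weighted_chains" "d @ [(p', e')] \<in> weighted_chains"
        using snoc.prems by (auto simp: pe c' pe')
      then have mem: "c \<in> weighted_chains" "p \<in> shapes" "0 < e"
          "d \<in> weighted_chains" "p' \<in> shapes" "0 < e'"
        by (auto simp: weighted_chains_snoc)
      have "inflate p e (assemble c) = inflate p' e' (assemble d)"
        using snoc.prems(3) by (simp add: pe c' pe' assemble_snoc)
      then have "p = p' \<and> e = e' \<and> assemble c = assemble d"
        using mem assemble[OF mem(1)] assemble[OF mem(4)] wc[THEN weighted_chains_shape_less]
        by (intro inflate_inject) auto
      then show ?thesis
        using snoc.IH[OF mem(1,4)] by (simp add: pe c' pe')
    qed
  qed
qed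

text \<open>With transitivity this allows any shape above the final one to be appended to the
  chain.\<close>

lemma weighted_chains_shape_le:
  assumes "c \<in> weighted_chains" "x \<in> set c"
  shows "fst x = cyl_shape (assemble c) \<or> shape_less (fst x) (cyl_shape (assemble c))"
proof (cases c rule: rev_cases)
  case (snoc d y)
  then show ?thesis
    using assms assemble[OF assms(1)] weighted_chains_snoc[of d "fst y" "snd y"] by auto
qed (use assms in simp)

text \<open>Removing the bottom levels up to the smallest part lowers the total number of entries;
  the induction hypothesis provides a chain for the remainder, to which the removed shape is
  appended.\<close>

lemma assemble_surj:
  "\<Lambda> \<in> cylindric_partitions (2, 1) \<Longrightarrow> \<Lambda> \<in> assemble ` weighted_chains"
proof (induction "weight (cyl_shape \<Lambda>)" arbitrary: \<Lambda> rule: less_induct)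
  case less
  show ?case
  proof (cases "\<Lambda> = ([], [])")
    case True
    have "[] \<in> weighted_chains" by (simp add: weighted_chains_def)
    then show ?thesis using True assemble_Nil by force
  next
    case False
    define e where "e = Min (set (fst \<Lambda>) \<union> set (snd \<Lambda>))"
    note d = deflate_Min[OF less.prems False e_def]
    have "weight (cyl_shape (deflate e \<Lambda>)) < weight (cyl_shape \<Lambda>)"
      using d(3) by (auto simp: shape_less_def weight_def prod_eq_iff)
    then have "deflate e \<Lambda> \<in> assemble ` weighted_chains"
      using d(2) by (rule less.hyps)
    then obtain c where c: "c \<in> weighted_chains" "assemble c = deflate e \<Lambda>"
      by auto
    have "shape_less (fst x) (cyl_shape \<Lambda>)" if "x \<in> set c" for x
      using weighted_chains_shape_le[OF c(1) that] d(3) transp_shape_less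
      unfolding c(2) by (auto dest: transpD)
    then have "c @ [(cyl_shape \<Lambda>, e)] \<in> weighted_chains"
      using c(1) d(1) cyl_shape_mem_shapes[OF less.prems False] by (simp add: weighted_chains_snoc)
    moreover have "assemble (c @ [(cyl_shape \<Lambda>, e)]) = \<Lambda>"
      using c(2) d(4) by (simp add: assemble_snoc)
    ultimately show ?thesis by force
  qed
qed

lemma bij_betw_assemble: "bij_betw assemble weighted_chains (cylindric_partitions (2, 1))"
proof (rule bij_betw_imageI[OF inj_on_assemble], rule equalityI)
  show "assemble ` weighted_chains \<subseteq> cylindric_partitions (2, 1)"
    using assemble by (rule image_subsetI[OF conjunct1])
  show "cylindric_partitions (2, 1) \<subseteq> assemble ` weighted_chains"
    by (rule subsetI) (rule assemble_surj)
qed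

section \<open>Generating functions\<close>

definition chain_monomial :: "(shape \<times> nat) list \<Rightarrow> zu_series" where
  "chain_monomial c = (\<Prod>x\<leftarrow>c. u_var * z_var ^ snd x * q_var ^ (snd x * weight (fst x)))"

lemma chain_monomial_eq:
  assumes "c \<in> weighted_chains"
  shows "q_var ^ cyl_size (assemble c) * z_var ^ cyl_max (assemble c) * u_var ^ cyl_st (assemble c)
    = chain_monomial c"
proof -
  have "chain_monomial c = q_var ^ (\<Sum>x\<leftarrow>c. snd x * weight (fst x)) *
      z_var ^ (\<Sum>x\<leftarrow>c. snd x) * u_var ^ length c"
    unfolding chain_monomial_def by (induction c) (simp_all add: power_add mult_ac)
  then show ?thesis
    using assemble[OF assms] by simp
qed

lemma finite_lists_sum_le: "finite {xs. (\<forall>x\<in>set xs. 0 < x) \<and> sum_list xs \<le> (n::nat)}"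
proof (rule finite_subset)
  show "finite {xs. set xs \<subseteq> {..n} \<and> length xs \<le> n}"
    by (rule finite_lists_length_le) simp
  have "length xs \<le> sum_list xs" if "\<forall>x\<in>set xs. 0 < x" for xs :: "nat list"
    using that by (induction xs) auto
  then show "{xs. (\<forall>x\<in>set xs. 0 < x) \<and> sum_list xs \<le> n}
      \<subseteq> {xs. set xs \<subseteq> {..n} \<and> length xs \<le> n}"
    by (force dest: member_le_sum_list)
qed

lemma finite_cyl_size: "finite {\<Lambda>\<in>cylindric_partitions c. cyl_size \<Lambda> = n}"
proof (rule finite_subset)
  let ?L = "{xs. (\<forall>x\<in>set xs. 0 < x) \<and> sum_list xs \<le> n}"
  show "finite (?L \<times> ?L)"
    using finite_lists_sum_le by simp
  show "{\<Lambda>\<in>cylindric_partitions c. cyl_size \<Lambda> = n} \<subseteq> ?L \<times> ?L"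
    by (auto simp: cylindric_partitions_def cyl_size_def is_partition_def)
qed

lemma locally_finite_cylindric:
  "locally_finite (\<lambda>\<Lambda>. q_var ^ cyl_size \<Lambda> * z_var ^ cyl_max \<Lambda> * u_var ^ cyl_st \<Lambda>)
     (cylindric_partitions c)"
  unfolding locally_finite_def
proof
  fix n
  \<comment> \<open>Each term is a monomial in q of degree \<open>s\<close>, so coefficient
    \<open>n\<close> sees only the finitely many partitions of size \<open>n\<close>.\<close>
  have "fps_nth (q_var ^ s * z_var ^ k * u_var ^ l) n = 0" if "s \<noteq> n" for s k l
  proof -
    have "q_var ^ s * z_var ^ k * u_var ^ l =
        fps_const ([:[:0, 1:]:] ^ k * [:0, 1:] ^ l) * fps_X ^ s"
      by (simp add: q_var_def z_var_def u_var_def fps_const_power mult_ac fps_const_mult[symmetric]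
          del: fps_const_mult)
    then show ?thesis
      using that by (simp only: fps_const_mult_X_power_nth) simp
  qed
  then have "{\<Lambda>\<in>cylindric_partitions c.
      fps_nth (q_var ^ cyl_size \<Lambda> * z_var ^ cyl_max \<Lambda> * u_var ^ cyl_st \<Lambda>) n \<noteq> 0}
    \<subseteq> {\<Lambda>\<in>cylindric_partitions c. cyl_size \<Lambda> = n}"
    by blast
  then show "finite {\<Lambda>\<in>cylindric_partitions c.
      fps_nth (q_var ^ cyl_size \<Lambda> * z_var ^ cyl_max \<Lambda> * u_var ^ cyl_st \<Lambda>) n \<noteq> 0}"
    by (rule finite_subset) (rule finite_cyl_size)
qed

text \<open>Finiteness is pulled back along the injection \<open>assemble\<close>, under which the
  terms agree.\<close>

lemma locally_finite_chain_monomial: "locally_finite chain_monomial weighted_chains"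
  unfolding locally_finite_def
proof
  fix n
  let ?f = "\<lambda>\<Lambda>. q_var ^ cyl_size \<Lambda> * z_var ^ cyl_max \<Lambda> * u_var ^ cyl_st \<Lambda>"
  let ?N = "{c\<in>weighted_chains. fps_nth (chain_monomial c) n \<noteq> 0}"
  have "finite {\<Lambda>\<in>cylindric_partitions (2, 1). fps_nth (?f \<Lambda>) n \<noteq> 0}"
    using locally_finite_cylindric[of "(2, 1)"] unfolding locally_finite_def by (rule spec)
  moreover have "assemble ` ?N \<subseteq> {\<Lambda>\<in>cylindric_partitions (2, 1). fps_nth (?f \<Lambda>) n \<noteq> 0}"
  proof (rule image_subsetI)
    fix c assume "c \<in> ?N"
    then show "assemble c \<in> {\<Lambda>\<in>cylindric_partitions (2, 1). fps_nth (?f \<Lambda>) n \<noteq> 0}"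
      using assemble[of c] chain_monomial_eq[of c] by simp
  qed
  ultimately have "finite (assemble ` ?N)"
    by (rule rev_finite_subset)
  then show "finite ?N"
    by (rule finite_imageD) (rule inj_on_subset[OF inj_on_assemble], simp)
qed

section \<open>Summation over multiplicities, shapes and weights\<close>

text \<open>For a fixed chain of shapes the multiplicities vary independently. Fibring over the
  multiplicity of the first shape splits off one geometric series at a time.\<close>

lemma infsum_shape_chain:
  assumes "set ps \<subseteq> shapes" "sorted_wrt shape_less ps"
  shows "infsum chain_monomial {c. map fst c = ps \<and> (\<forall>x\<in>set c. 0 < snd x)}
    = (\<Prod>p\<leftarrow>ps. geom_factor (weight p))"
  using assms
proof (induction ps)
  case Nil
  have "{c :: (shape \<times> nat) list. map fst c = [] \<and> (\<forall>x\<in>set c. 0 < snd x)} = {[]}" by auto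
  then show ?case by (simp add: chain_monomial_def)
next
  case (Cons p ps)
  define T where "T qs = {c :: (shape \<times> nat) list. map fst c = qs \<and> (\<forall>x\<in>set c. 0 < snd x)}"
    for qs
  let ?m = "\<lambda>e. u_var * z_var ^ e * q_var ^ (e * weight p)"
  have lf: "locally_finite chain_monomial (T (p # ps))" "locally_finite chain_monomial (T ps)"
    using Cons.prems
    by (auto intro!: locally_finite_subset[OF locally_finite_chain_monomial]
        simp: T_def weighted_chains_def)
  have pos: "0 < weight p"
    using Cons.prems by (auto simp: shapes_def weight_def)
  have img: "(\<lambda>c. snd (hd c)) ` T (p # ps) \<subseteq> {1..}"
    by (auto simp: T_def map_eq_Cons_conv)
  have fiber: "infsum chain_monomial {c\<in>T (p # ps). snd (hd c) = e} = ?m e * infsum chain_monomial (T ps)"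
    if "e \<in> {1..}" for e
  proof -
    have "bij_betw ((#) (p, e)) (T ps) {c\<in>T (p # ps). snd (hd c) = e}"
      by (rule bij_betwI[where g = tl]) (use that in \<open>auto simp: T_def map_eq_Cons_conv simp del: split_paired_Ex\<close>)
    then have "infsum chain_monomial {c\<in>T (p # ps). snd (hd c) = e}
        = (\<Sum>\<^sub>\<infinity>c\<in>T ps. chain_monomial ((p, e) # c))"
      by (rule infsum_reindex_bij_betw[symmetric])
    also have "\<dots> = (\<Sum>\<^sub>\<infinity>c\<in>T ps. ?m e * chain_monomial c)"
      by (simp add: chain_monomial_def)
    also have "\<dots> = ?m e * infsum chain_monomial (T ps)"
      by (rule infsum_cmult_locally_finite[OF lf(2)])
    finally show ?thesis .
  qed
  have "infsum chain_monomial (T (p # ps)) = (\<Sum>\<^sub>\<infinity>e\<in>{1..}. infsum chain_monomial (T ps) * ?m e)"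
    unfolding infsum_fibers[OF lf(1) img]
    by (rule infsum_cong) (simp only: fiber mult.commute)
  also have "\<dots> = infsum chain_monomial (T ps) * geom_factor (weight p)"
    unfolding infsum_cmult_locally_finite[OF locally_finite_geom[OF pos]] infsum_geom[OF pos] ..
  finally show ?case
    using Cons by (simp add: T_def mult.commute)
qed

definition weights :: "(shape \<times> nat) list \<Rightarrow> nat list" where
  "weights c = map weight (map fst c)"

text \<open>A strict componentwise increase raises the coordinate sum, and \<open>shapes\<close>
  excludes weight 0.\<close>

lemma weights_mem_inc_seqs:
  assumes "c \<in> weighted_chains"
  shows "weights c \<in> inc_seqs (length c)"
proof -
  have "sorted_wrt shape_less (map fst c)" "set (map fst c) \<subseteq> shapes"
    using assms by (auto simp: weighted_chains_def)
  moreover have "weight p < weight p'" if "shape_less p p'" for p p'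
    using that by (auto simp: shape_less_def weight_def prod_eq_iff)
  ultimately show ?thesis
    by (auto simp: inc_seqs_def weights_def sorted_wrt_map shapes_def weight_def
        elim!: sorted_wrt_mono_rel[rotated])
qed

text \<open>The contribution of a shape chain depends only on its weights, so the sum is this common
  product times the number of chains.\<close>

lemma infsum_weights:
  assumes "js \<in> inc_seqs m"
  shows "infsum chain_monomial {c\<in>weighted_chains. weights c = js}
    = of_nat (\<Prod>r\<leftarrow>run_lengths js. fib (2 + r)) * (\<Prod>k<m. geom_factor (js ! k))"
proof -
  have js: "sorted_wrt (<) js" "\<forall>j\<in>set js. 0 < j" "length js = m"
    using assms by (auto simp: inc_seqs_def)
  let ?A = "{c\<in>weighted_chains. weights c = js}"
  have lf: "locally_finite chain_monomial ?A"
    by (rule locally_finite_subset[OF locally_finite_chain_monomial]) auto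
  have img: "map fst ` ?A \<subseteq> shape_chains js"
    by (auto simp: weighted_chains_def weights_def shape_chains_def)
  have fiber: "infsum chain_monomial {c\<in>?A. map fst c = ps} = (\<Prod>k<m. geom_factor (js ! k))"
    if ps: "ps \<in> shape_chains js" for ps
  proof -
    have "{c\<in>?A. map fst c = ps} = {c. map fst c = ps \<and> (\<forall>x\<in>set c. 0 < snd x)}"
    proof (rule set_eqI)
      fix c show "c \<in> {c\<in>?A. map fst c = ps} \<longleftrightarrow> c \<in> {c. map fst c = ps \<and> (\<forall>x\<in>set c. 0 < snd x)}"
      proof (cases "map fst c = ps")
        case True
        show ?thesis
          unfolding weighted_chains_def weights_def mem_Collect_eq True
          using ps by (simp add: shape_chains_def)
      qed simp
    qed
    then have "infsum chain_monomial {c\<in>?A. map fst c = ps} = (\<Prod>p\<leftarrow>ps. geom_factor (weight p))"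
      using ps infsum_shape_chain[of ps] by (simp add: shape_chains_def)
    also have "\<dots> = (\<Prod>j\<leftarrow>js. geom_factor j)"
      using ps by (auto simp: shape_chains_def o_def)
    also have "\<dots> = (\<Prod>k<m. geom_factor (js ! k))"
      using js(3) by (simp add: prod.list_conv_set_nth atLeast0LessThan)
    finally show ?thesis .
  qed
  have "infsum chain_monomial ?A = (\<Sum>\<^sub>\<infinity>ps\<in>shape_chains js. \<Prod>k<m. geom_factor (js ! k))"
    unfolding infsum_fibers[OF lf img] by (rule infsum_cong) (rule fiber)
  also have "\<dots> = of_nat (card (shape_chains js)) * (\<Prod>k<m. geom_factor (js ! k))"
    using finite_shape_chains[OF js(2)] by simp
  finally show ?thesis
    by (simp only: card_shape_chains[OF js(1,2)])
qed

lemma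
  fixes m :: nat
  defines "F \<equiv> \<lambda>js. of_nat (\<Prod>r\<leftarrow>run_lengths js. fib (2 + r)) * (\<Prod>k<m. geom_factor (js ! k))"
  shows summable_inc_seqs: "F summable_on inc_seqs m"
    and infsum_inc_seqs: "infsum F (inc_seqs m) = infsum chain_monomial {c\<in>weighted_chains. length c = m}"
proof -
  let ?A = "{c\<in>weighted_chains. length c = m}"
  have lf: "locally_finite chain_monomial ?A"
    by (rule locally_finite_subset[OF locally_finite_chain_monomial]) auto
  have img: "weights ` ?A \<subseteq> inc_seqs m"
    using weights_mem_inc_seqs by auto
  have fiber: "infsum chain_monomial {c\<in>?A. weights c = js} = F js" if "js \<in> inc_seqs m" for js
  proof -
    have "{c\<in>?A. weights c = js} = {c\<in>weighted_chains. weights c = js}"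
      using that by (auto simp: weights_def inc_seqs_def)
    then show ?thesis
      using infsum_weights[OF that] by (simp only: F_def)
  qed
  have "(\<lambda>js. infsum chain_monomial {c\<in>?A. weights c = js}) summable_on inc_seqs m"
    by (rule locally_finite_summable[OF locally_finite_fibers[OF lf img]])
  also have "?this \<longleftrightarrow> F summable_on inc_seqs m"
    by (rule summable_on_cong) (rule fiber)
  finally show "F summable_on inc_seqs m" .
  have "infsum chain_monomial ?A = (\<Sum>\<^sub>\<infinity>js\<in>inc_seqs m. infsum chain_monomial {c\<in>?A. weights c = js})"
    by (rule infsum_fibers[OF lf img])
  also have "\<dots> = infsum F (inc_seqs m)"
    by (rule infsum_cong) (rule fiber)
  finally show "infsum F (inc_seqs m) = infsum chain_monomial ?A" ..
qed

theorem mainTheorem3: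
  shows "(\<lambda>\<Lambda>. q_var ^ cyl_size \<Lambda> * z_var ^ cyl_max \<Lambda> * u_var ^ cyl_st \<Lambda>)
           summable_on cylindric_partitions (2, 1)
       \<and> (\<forall>m\<ge>1. (\<lambda>js. of_nat (\<Prod>r\<leftarrow>run_lengths js. fib (2 + r)) * (\<Prod>k<m. geom_factor (js ! k)))
           summable_on inc_seqs m)
       \<and> (\<lambda>m. \<Sum>\<^sub>\<infinity>js\<in>inc_seqs m.
             of_nat (\<Prod>r\<leftarrow>run_lengths js. fib (2 + r)) * (\<Prod>k<m. geom_factor (js ! k)))
           summable_on {1..}
       \<and> (\<Sum>\<^sub>\<infinity>\<Lambda>\<in>cylindric_partitions (2, 1).
             q_var ^ cyl_size \<Lambda> * z_var ^ cyl_max \<Lambda> * u_var ^ cyl_st \<Lambda>)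
         = 1 + (\<Sum>\<^sub>\<infinity>m\<in>{1..}. \<Sum>\<^sub>\<infinity>js\<in>inc_seqs m.
             of_nat (\<Prod>r\<leftarrow>run_lengths js. fib (2 + r)) * (\<Prod>k<m. geom_factor (js ! k)))"
  \<comment> \<open>The inner sums become sums of chain monomials over the chains of length
    \<open>m\<close>.\<close>
  unfolding infsum_inc_seqs
proof (intro conjI allI impI)
  let ?G = "\<lambda>m. infsum chain_monomial {c\<in>weighted_chains. length c = m}"
  show "(\<lambda>\<Lambda>. q_var ^ cyl_size \<Lambda> * z_var ^ cyl_max \<Lambda> * u_var ^ cyl_st \<Lambda>)
      summable_on cylindric_partitions (2, 1)"
    by (rule locally_finite_summable[OF locally_finite_cylindric])
  show "(\<lambda>js. of_nat (\<Prod>r\<leftarrow>run_lengths js. fib (2 + r)) * (\<Prod>k<m. geom_factor (js ! k)))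
      summable_on inc_seqs m" for m
    by (rule summable_inc_seqs)
  \<comment> \<open>Length 0 is included so that the fibres cover all chains; it is split off below,
    where the empty chain yields the summand 1.\<close>
  have lf: "locally_finite ?G (insert 0 {1..})"
    by (rule locally_finite_fibers[OF locally_finite_chain_monomial]) (auto simp: Suc_le_eq)
  then have "locally_finite ?G {1..}"
    by (rule locally_finite_subset) auto
  then show "?G summable_on {1..}"
    by (rule locally_finite_summable)
  have "(\<Sum>\<^sub>\<infinity>\<Lambda>\<in>cylindric_partitions (2, 1).
        q_var ^ cyl_size \<Lambda> * z_var ^ cyl_max \<Lambda> * u_var ^ cyl_st \<Lambda>)
      = (\<Sum>\<^sub>\<infinity>c\<in>weighted_chains. q_var ^ cyl_size (assemble c) * z_var ^ cyl_max (assemble c) *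
          u_var ^ cyl_st (assemble c))"
    by (rule infsum_reindex_bij_betw[OF bij_betw_assemble, symmetric])
  also have "\<dots> = infsum chain_monomial weighted_chains"
    by (rule infsum_cong) (rule chain_monomial_eq)
  also have "\<dots> = infsum ?G (insert 0 {1..})"
    by (rule infsum_fibers[OF locally_finite_chain_monomial]) (auto simp: Suc_le_eq)
  also have "\<dots> = ?G 0 + infsum ?G {1..}"
    by (rule infsum_insert_locally_finite[OF lf]) simp
  also have "{c\<in>weighted_chains. length c = 0} = {[]}"
    by (auto simp: weighted_chains_def)
  also have "infsum chain_monomial {[]} = 1"
    by (simp add: chain_monomial_def)
  finally show "(\<Sum>\<^sub>\<infinity>\<Lambda>\<in>cylindric_partitions (2, 1).
        q_var ^ cyl_size \<Lambda> * z_var ^ cyl_max \<Lambda> * u_var ^ cyl_st \<Lambda>) = 1 + infsum ?G {1..}" .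
qed

end
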